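(* If $A\in 2^{\omega}$ is $\Delta^0_2$ and not $K$-trivial, then $A\notin\mathcal{KT}(\Delta^0_2)$ and $A\notin\mathcal{LK}(\Delta^0_2)$.
   Context: Reals are elements of $2^{\omega}$ (infinite binary sequences); $A\upharpoonright n$ is the initial segment of $A$ of length $n$. $K(\sigma)$ is the prefix-free Kolmogorov complexity of the finite binary string $\sigma\in 2^{<\omega}$ with respect to a fixed universal prefix-free (oracle) machine, $K^A(\sigma)$ is its relativization to the oracle $A$, and for $n \in \omega$, $K(n)$ denotes the complexity of the string of $n$ zeros. A real $A$ is $K$-trivial if there is a constant $c$ such that $K(A\upharpoonright n)\leq K(n)+c$ for all $n$. An order is a function that is nondecreasing and unbounded (not necessarily recursive); for functions $f:2^{<\omega}\to\omega$, strings are taken in length-lexicographic order (identifying $2^{<\omega}$ with $\omega$). For $g:\omega\to\omega$, $\mathcal{KT}(g)$ is the set of reals $A$ for which there is a constant $c$ such that for all $n\in\omega$, $K(A\upharpoonright n)\leq K(n)+g(n)+c$. For $f:2^{<\omega}\to\omega$, $\mathcal{LK}(f)$ is the set of reals $A$ for which there is a constant $c$ such that for all $\sigma\in 2^{<\omega}$, $K(\sigma)\leq K^A(\sigma)+f(\sigma)+c$. $\mathcal{KT}(\Delta^0_2)$ is the intersection of $\mathcal{KT}(g)$ over all $\Delta^0_2$ orders $g:\omega\to\omega$, and $\mathcal{LK}(\Delta^0_2)$ is the intersection of $\mathcal{LK}(f)$ over all $\Delta^0_2$ orders $f:2^{<\omega}\to\omega$. *)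

theory Defs
  imports Main "HOL-Library.Sublist"
begin

text \<open>Reals are elements of Cantor space.\<close>

type_synonym cantor = "nat \<Rightarrow> bool"

definition restr :: "cantor \<Rightarrow> nat \<Rightarrow> bool list" where
  "restr A n = map A [0..<n]"


text \<open>The identification of binary strings with natural numbers along the
  length-lexicographic order: the empty string, 0, 1, 00, 01, 10, 11, 000, ...
  become 0, 1, 2, 3, 4, 5, 6, 7, ... See \<open>str_code_less_iff\<close>, \<open>bij_str_code\<close>.\<close>

definition str_code :: "bool list \<Rightarrow> nat" where
  "str_code p = foldl (\<lambda>n b. 2 * n + 1 + of_bool b) 0 p"

definition str_decode :: "nat \<Rightarrow> bool list" where
  "str_decode = inv str_code"

lemma str_code_Nil [simp]: "str_code [] = 0"
  by (simp add: str_code_def)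

lemma str_code_snoc [simp]: "str_code (p @ [b]) = 2 * str_code p + 1 + of_bool b"
  by (simp add: str_code_def)

lemma str_code_bounds: "2 ^ length p \<le> str_code p + 1 \<and> str_code p + 1 < 2 ^ (length p + 1)"
proof (induction p rule: rev_induct)
  case (snoc b p)
  then show ?case by (cases b) auto
qed simp

lemma str_code_append: "str_code (p @ q) + 1 = 2 ^ length q * str_code p + (str_code q + 1)"
proof (induction q rule: rev_induct)
  case (snoc b q)
  have "str_code (p @ q @ [b]) = 2 * str_code (p @ q) + 1 + of_bool b"
    using str_code_snoc[of "p @ q" b] by simp
  then show ?case using snoc by (simp add: algebra_simps)
qed simp

lemma inj_str_code: "inj str_code"
proof (rule injI)
  fix p q :: "bool list"
  assume "str_code p = str_code q"
  then show "p = q"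
  proof (induction p arbitrary: q rule: rev_induct)
    case Nil
    then show ?case by (cases q rule: rev_cases) auto
  next
    case (snoc b p)
    then obtain q' b' where q: "q = q' @ [b']"
      by (cases q rule: rev_cases) auto
    have eq: "2 * str_code p + of_bool b = 2 * str_code q' + of_bool b'"
      using snoc.prems q by simp
    then have "b = b'" by (cases b; cases b'; simp; presburger)
    with eq show ?case using snoc.IH q by auto
  qed
qed

lemma surj_str_code: "\<exists>p. str_code p = n"
proof (induction n rule: less_induct)
  case (less n)
  show ?case
  proof (cases "n = 0")
    case True
    then show ?thesis using str_code_Nil by blast
  next
    case False
    obtain p where p: "str_code p = (n - 1) div 2"
      using less[of "(n - 1) div 2"] False by (meson div_le_dividend diff_less le_less_trans less_numeral_extra(1) not_gr_zero)
    have "str_code (p @ [odd (n - 1)]) = n"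
      using False p by (simp add: of_bool_def) presburger
    then show ?thesis by blast
  qed
qed

lemma bij_str_code: "bij str_code"
  using inj_str_code surj_str_code by (metis bijI surjI)

lemma str_decode_code [simp]: "str_decode (str_code p) = p"
  by (simp add: str_decode_def inj_str_code)

lemma str_code_decode [simp]: "str_code (str_decode n) = n"
  by (simp add: str_decode_def bij_str_code bij_is_surj surj_f_inv_f)

lemma str_code_less_if_lenlex:
  assumes "(p, q) \<in> lenlex {(False, True)}"
  shows "str_code p < str_code q"
proof (cases "length p < length q")
  case True
  then have "(2::nat) ^ (length p + 1) \<le> 2 ^ length q"
    by (intro power_increasing) auto
  then show ?thesis using str_code_bounds[of p] str_code_bounds[of q] by linarith
next
  case False
  then have len: "length p = length q" and "(p, q) \<in> lex {(False, True)}"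
    using assms by (auto simp: lenlex_conv)
  then obtain r p' q' where pq: "p = r @ [False] @ p'" "q = r @ [True] @ q'"
    by (auto simp: lex_conv)
  have l: "length p' = length q'" using len pq by simp
  have "str_code p + 1 = 2 ^ length p' * str_code (r @ [False]) + (str_code p' + 1)"
    using str_code_append[of "r @ [False]" p'] pq by simp
  moreover have "str_code q + 1 = 2 ^ length p' * str_code (r @ [True]) + (str_code q' + 1)"
    using str_code_append[of "r @ [True]" q'] pq l by simp
  moreover have "(2::nat) ^ length p' * str_code (r @ [True])
      = 2 ^ length p' * str_code (r @ [False]) + 2 ^ length p'"
    by (simp add: algebra_simps)
  ultimately show ?thesis
    using str_code_bounds[of p'] str_code_bounds[of q'] l by simp
qed

lemma str_code_less_iff: "str_code p < str_code q \<longleftrightarrow> (p, q) \<in> lenlex {(False, True)}"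
proof
  assume less: "str_code p < str_code q"
  have "total (lenlex {(False, True)})"
    by (rule total_lenlex) (auto simp: total_on_def)
  then have "p = q \<or> (p, q) \<in> lenlex {(False, True)} \<or> (q, p) \<in> lenlex {(False, True)}"
    by (auto simp: total_on_def)
  then show "(p, q) \<in> lenlex {(False, True)}"
    using less str_code_less_if_lenlex by fastforce
qed (rule str_code_less_if_lenlex)


text \<open>Partial recursive functions relative to a set \<open>X\<close>. A program has no fixed
  arity; it computes a \<open>k\<close>-ary partial function when run on lists of length \<open>k\<close>.
  \<open>Query\<close> asks for the membership of its argument in \<open>X\<close>.\<close>

datatype prog =
    Zero
  | Succ
  | Query
  | Proj nat
  | Comp prog "prog list"
  | PrimRec prog prog
  | Mu prog

inductive computes :: "cantor \<Rightarrow> prog \<Rightarrow> nat list \<Rightarrow> nat \<Rightarrow> bool" for X :: cantor where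
  zero: "computes X Zero xs 0"
| succ: "computes X Succ [x] (Suc x)"
| query: "computes X Query [x] (of_bool (X x))"
| proj: "i < length xs \<Longrightarrow> computes X (Proj i) xs (xs ! i)"
| comp: "list_all2 (\<lambda>g y. computes X g xs y) gs ys \<Longrightarrow> computes X f ys z
    \<Longrightarrow> computes X (Comp f gs) xs z"
| primrec_0: "computes X f xs y \<Longrightarrow> computes X (PrimRec f g) (0 # xs) y"
| primrec_Suc: "computes X (PrimRec f g) (n # xs) r \<Longrightarrow> computes X g (n # r # xs) y
    \<Longrightarrow> computes X (PrimRec f g) (Suc n # xs) y"
| mu: "computes X f (n # xs) 0 \<Longrightarrow> (\<forall>m<n. \<exists>k. computes X f (m # xs) (Suc k))
    \<Longrightarrow> computes X (Mu f) xs n"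

abbreviation empty_real :: cantor where
  "empty_real \<equiv> \<lambda>_. False"


text \<open>The arithmetical hierarchy at level 2. A predicate on lists stands for the
  \<open>k\<close>-ary relation it describes on lists of length \<open>k\<close>.\<close>

definition recursive_rel :: "nat \<Rightarrow> (nat list \<Rightarrow> bool) \<Rightarrow> bool" where
  "recursive_rel k R \<longleftrightarrow>
    (\<exists>e. \<forall>xs. length xs = k \<longrightarrow> computes empty_real e xs (of_bool (R xs)))"

definition Sigma2 :: "nat \<Rightarrow> (nat list \<Rightarrow> bool) \<Rightarrow> bool" where
  "Sigma2 k P \<longleftrightarrow> (\<exists>R. recursive_rel (k + 2) R \<and>
    (\<forall>xs. length xs = k \<longrightarrow> (P xs \<longleftrightarrow> (\<exists>x. \<forall>y. R (x # y # xs)))))"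

definition Pi2 :: "nat \<Rightarrow> (nat list \<Rightarrow> bool) \<Rightarrow> bool" where
  "Pi2 k P \<longleftrightarrow> (\<exists>R. recursive_rel (k + 2) R \<and>
    (\<forall>xs. length xs = k \<longrightarrow> (P xs \<longleftrightarrow> (\<forall>x. \<exists>y. R (x # y # xs)))))"

definition Delta2 :: "nat \<Rightarrow> (nat list \<Rightarrow> bool) \<Rightarrow> bool" where
  "Delta2 k P \<longleftrightarrow> Sigma2 k P \<and> Pi2 k P"

definition Delta2_real :: "cantor \<Rightarrow> bool" where
  "Delta2_real A \<longleftrightarrow> Delta2 1 (\<lambda>xs. A (xs ! 0))"

text \<open>A function is \<open>\<Delta>\<^sup>0\<^sub>2\<close> if its graph is.\<close>

definition Delta2_fun :: "(nat \<Rightarrow> nat) \<Rightarrow> bool" where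
  "Delta2_fun g \<longleftrightarrow> Delta2 2 (\<lambda>xs. g (xs ! 0) = xs ! 1)"


text \<open>A machine maps an element of Cantor space (the set it may query) and a program
  string to an output string, if it halts. The domain has to be prefix-free for every
  queried set.\<close>

type_synonym machine = "cantor \<Rightarrow> bool list \<Rightarrow> bool list option"

definition computable_machine :: "machine \<Rightarrow> bool" where
  "computable_machine M \<longleftrightarrow>
    (\<exists>e. \<forall>X p q. M X p = Some q \<longleftrightarrow> computes X e [str_code p] (str_code q))"

definition prefix_free :: "bool list set \<Rightarrow> bool" where
  "prefix_free S \<longleftrightarrow> (\<forall>p\<in>S. \<forall>q\<in>S. \<not> strict_prefix p q)"

definition prefix_free_machine :: "machine \<Rightarrow> bool" where
  "prefix_free_machine M \<longleftrightarrow> computable_machine M \<and> (\<forall>X. prefix_free (dom (M X)))"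

text \<open>The coding prefix \<open>r\<close> of a simulated machine does not depend on \<open>X\<close>.\<close>

definition universal_machine :: "machine \<Rightarrow> bool" where
  "universal_machine U \<longleftrightarrow> prefix_free_machine U \<and>
    (\<forall>M. prefix_free_machine M \<longrightarrow> (\<exists>r. \<forall>X p. U X (r @ p) = M X p))"

text \<open>\<open>KX U X\<close> is complexity relative to \<open>X\<close>, as measured by \<open>U\<close>; the minimum exists
  for every string when \<open>U\<close> is universal. Unrelativized complexity is complexity
  relative to the empty set, and \<open>Kn U n\<close> is the complexity of the string of \<open>n\<close> zeros.\<close>

definition KX :: "machine \<Rightarrow> cantor \<Rightarrow> bool list \<Rightarrow> nat" where
  "KX U X s = (LEAST n. \<exists>p. U X p = Some s \<and> length p = n)"

definition K :: "machine \<Rightarrow> bool list \<Rightarrow> nat" where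
  "K U s = KX U empty_real s"

definition Kn :: "machine \<Rightarrow> nat \<Rightarrow> nat" where
  "Kn U n = K U (replicate n False)"

definition K_trivial :: "machine \<Rightarrow> cantor \<Rightarrow> bool" where
  "K_trivial U A \<longleftrightarrow> (\<exists>c. \<forall>n. K U (restr A n) \<le> Kn U n + c)"

definition KT :: "machine \<Rightarrow> (nat \<Rightarrow> nat) \<Rightarrow> cantor set" where
  "KT U g = {A. \<exists>c. \<forall>n. K U (restr A n) \<le> Kn U n + g n + c}"

definition LK :: "machine \<Rightarrow> (bool list \<Rightarrow> nat) \<Rightarrow> cantor set" where
  "LK U f = {A. \<exists>c. \<forall>s. K U s \<le> KX U A s + f s + c}"

definition is_order :: "(nat \<Rightarrow> nat) \<Rightarrow> bool" where
  "is_order g \<longleftrightarrow> mono g \<and> (\<forall>b. \<exists>n. g n > b)"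

definition KT_Delta2 :: "machine \<Rightarrow> cantor set" where
  "KT_Delta2 U = \<Inter> {KT U g | g. is_order g \<and> Delta2_fun g}"

definition LK_Delta2 :: "machine \<Rightarrow> cantor set" where
  "LK_Delta2 U = \<Inter> {LK U f | f. is_order (f \<circ> str_decode) \<and> Delta2_fun (f \<circ> str_decode)}"

end

theory Submission
  imports Defs
begin

text \<open>Let \<open>h n = K (A\<restriction>n) - K n\<close>, and let \<open>g n\<close> be half the maximum of \<open>h\<close> on \<open>{0..n}\<close>. Both are
  limits of recursive approximations, because \<open>A\<close> is \<open>\<Delta>\<^sup>0\<^sub>2\<close> and \<open>K\<close> is approximable from above, so
  \<open>g\<close> is a \<open>\<Delta>\<^sup>0\<^sub>2\<close> order if \<open>A\<close> is not \<open>K\<close>-trivial. At an argument where \<open>h\<close> attains a new maximum it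
  is about twice \<open>g\<close>, hence \<open>A\<close> is not in \<open>KT g\<close>. Moreover the complexity of \<open>A\<restriction>n\<close> relative to \<open>A\<close> is
  at most \<open>K n\<close> up to a constant, so \<open>A\<close> is not in \<open>LK f\<close> for \<open>f \<sigma> = g (length \<sigma>)\<close> either.\<close>

section \<open>Functions that are recursive uniformly in an oracle\<close>

text \<open>The program is fixed before the oracle, as \<open>computable_machine\<close> requires;
  functions that ignore \<open>X\<close> fit in as a special case. Variables are positions in
  \<open>xs\<close>, in the manner of de Bruijn indices.\<close>

definition recf :: "nat \<Rightarrow> (cantor \<Rightarrow> nat list \<Rightarrow> nat) \<Rightarrow> bool" where
  "recf k F \<longleftrightarrow> (\<exists>e. \<forall>X xs. length xs = k \<longrightarrow> computes X e xs (F X xs))"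

lemma recf_cong:
  assumes "recf k F" "\<And>X xs. length xs = k \<Longrightarrow> F X xs = G X xs"
  shows "recf k G"
  using assms unfolding recf_def by metis

lemma recf_nth: "i < k \<Longrightarrow> recf k (\<lambda>X xs. xs ! i)"
  unfolding recf_def by (metis computes.proj)

lemma recf_drop_nth: "d + i < k \<Longrightarrow> recf k (\<lambda>X xs. drop d xs ! i)"
  by (rule recf_cong[OF recf_nth[of "d + i"]]) auto

text \<open>Each binder above a position contributes one \<open>drop\<close> to the variables outside of it.\<close>

lemma recf_drop_drop_nth: "d + d' + i < k \<Longrightarrow> recf k (\<lambda>X xs. drop d (drop d' xs) ! i)"
  using recf_drop_nth[of "d + d'" i k] by simp

lemma recf_drop_drop_drop_nth:
  "d + d' + d'' + i < k \<Longrightarrow> recf k (\<lambda>X xs. drop d (drop d' (drop d'' xs)) ! i)"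
  using recf_drop_nth[of "d + d' + d''" i k] by (simp add: add.assoc)

lemma recf_comp:
  assumes F: "recf (length Gs) F" and Gs: "\<And>G. G \<in> set Gs \<Longrightarrow> recf k G"
  shows "recf k (\<lambda>X xs. F X (map (\<lambda>G. G X xs) Gs))"
proof -
  obtain f where f: "\<And>X xs. length xs = length Gs \<Longrightarrow> computes X f xs (F X xs)"
    using F unfolding recf_def by blast
  obtain g where g: "\<And>G X xs. G \<in> set Gs \<Longrightarrow> length xs = k \<Longrightarrow> computes X (g G) xs (G X xs)"
    using Gs unfolding recf_def by metis
  have "computes X (Comp f (map g Gs)) xs (F X (map (\<lambda>G. G X xs) Gs))" if "length xs = k" for X xs
    using that by (intro computes.comp[where ys = "map (\<lambda>G. G X xs) Gs"])
      (auto simp: list_all2_conv_all_nth intro: f g)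
  then show ?thesis unfolding recf_def by blast
qed

lemma recf_comp1:
  assumes "recf 1 (\<lambda>X xs. h X (xs ! 0))" "recf k F"
  shows "recf k (\<lambda>X xs. h X (F X xs))"
  using recf_comp[of "[F]" "\<lambda>X xs. h X (xs ! 0)" k] assms by simp

lemma recf_comp2:
  assumes "recf 2 (\<lambda>X xs. h X (xs ! 0) (xs ! 1))" "recf k F" "recf k G"
  shows "recf k (\<lambda>X xs. h X (F X xs) (G X xs))"
  using recf_comp[of "[F, G]" "\<lambda>X xs. h X (xs ! 0) (xs ! 1)" k] assms
  by (auto simp: numeral_2_eq_2)

lemma recf_Suc:
  assumes "recf k F"
  shows "recf k (\<lambda>X xs. Suc (F X xs))"
proof (rule recf_comp1[OF _ assms])
  show "recf 1 (\<lambda>X xs. Suc (xs ! 0))"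
    unfolding recf_def by (rule exI[of _ Succ]) (auto simp: length_Suc_conv intro: computes.succ)
qed

lemma recf_query:
  assumes "recf k F"
  shows "recf k (\<lambda>X xs. of_bool (X (F X xs)))"
proof (rule recf_comp1[OF _ assms])
  show "recf 1 (\<lambda>X xs. of_bool (X (xs ! 0)))"
    unfolding recf_def
    by (rule exI[of _ Query]) (metis One_nat_def computes.query length_0_conv length_Suc_conv nth_Cons_0)
qed

lemma recf_const: "recf k (\<lambda>X xs. c)"
proof (induction c)
  case 0
  show ?case unfolding recf_def by (blast intro: computes.zero)
qed (rule recf_Suc)

text \<open>Tuples of recursive functions, for argument lists that are not literal lists of
  variables, such as \<open>drop d xs\<close>; \<open>recf_recl\<close> is then
  substitution.\<close>

definition recl :: "nat \<Rightarrow> nat \<Rightarrow> (cantor \<Rightarrow> nat list \<Rightarrow> nat list) \<Rightarrow> bool" where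
  "recl m k L \<longleftrightarrow> (\<exists>Gs. length Gs = k \<and> (\<forall>G\<in>set Gs. recf m G) \<and>
    (\<forall>X xs. length xs = m \<longrightarrow> L X xs = map (\<lambda>G. G X xs) Gs))"

lemma recl_length: "recl m k L \<Longrightarrow> length xs = m \<Longrightarrow> length (L X xs) = k"
  unfolding recl_def by auto

lemma recf_recl:
  assumes "recf k F" "recl m k L"
  shows "recf m (\<lambda>X xs. F X (L X xs))"
proof -
  obtain Gs where Gs: "length Gs = k" "\<And>G. G \<in> set Gs \<Longrightarrow> recf m G"
    "\<And>X xs. length xs = m \<Longrightarrow> L X xs = map (\<lambda>G. G X xs) Gs"
    using assms(2) unfolding recl_def by auto
  have "recf m (\<lambda>X xs. F X (map (\<lambda>G. G X xs) Gs))"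
    by (rule recf_comp) (use Gs assms(1) in auto)
  then show ?thesis by (rule recf_cong) (simp add: Gs(3))
qed

lemma recf_recl_nth: "recl m k L \<Longrightarrow> i < k \<Longrightarrow> recf m (\<lambda>X xs. L X xs ! i)"
  by (rule recf_recl[OF recf_nth])

lemma recl_map:
  assumes "\<And>g. g \<in> set gs \<Longrightarrow> recf m (\<lambda>X xs. H X xs g)"
  shows "recl m (length gs) (\<lambda>X xs. map (H X xs) gs)"
  unfolding recl_def by (rule exI[of _ "map (\<lambda>g X xs. H X xs g) gs"]) (auto intro: assms)

lemma recl_Nil: "recl m 0 (\<lambda>X xs. [])"
  unfolding recl_def by simp

lemma recl_Cons:
  assumes "recf m F" "recl m k L"
  shows "recl m (Suc k) (\<lambda>X xs. F X xs # L X xs)"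
proof -
  obtain Gs where "length Gs = k" "\<forall>G\<in>set Gs. recf m G"
    "\<forall>X xs. length xs = m \<longrightarrow> L X xs = map (\<lambda>G. G X xs) Gs"
    using assms(2) unfolding recl_def by auto
  with assms(1) show ?thesis
    unfolding recl_def by (intro exI[of _ "F # Gs"]) auto
qed

lemma recl_tl:
  assumes "recl m (Suc k) L"
  shows "recl m k (\<lambda>X xs. tl (L X xs))"
proof -
  obtain G Gs where "length Gs = k" "\<forall>G\<in>set (G # Gs). recf m G"
    "\<forall>X xs. length xs = m \<longrightarrow> L X xs = map (\<lambda>G. G X xs) (G # Gs)"
    using assms unfolding recl_def by (auto simp: length_Suc_conv)
  then show ?thesis
    unfolding recl_def by (intro exI[of _ Gs]) auto
qed

lemma recl_drop_id: "recl (k + d) k (\<lambda>X xs. drop d xs)"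
  unfolding recl_def
  by (rule exI[of _ "map (\<lambda>i X xs. xs ! (d + i)) [0..<k]"])
    (auto intro!: recf_nth nth_equalityI)

lemma recl_drop:
  assumes "recl m k L"
  shows "recl (m + d) k (\<lambda>X xs. L X (drop d xs))"
proof -
  obtain Gs where Gs: "length Gs = k" "\<forall>G\<in>set Gs. recf m G"
    "\<forall>X xs. length xs = m \<longrightarrow> L X xs = map (\<lambda>G. G X xs) Gs"
    using assms(1) unfolding recl_def by auto
  then show ?thesis
    unfolding recl_def
    by (intro exI[of _ "map (\<lambda>G X xs. G X (drop d xs)) Gs"])
      (auto intro: recf_recl recl_drop_id)
qed

lemma recf_drop: "recf k F \<Longrightarrow> recf (k + d) (\<lambda>X xs. F X (drop d xs))"
  by (rule recf_recl[OF _ recl_drop_id])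

text \<open>\<open>drop 2 ys\<close> holds the parameters, since \<open>primrec_Suc\<close> puts the
  counter and the previous value in front of them.\<close>

lemma recf_rec_nat:
  assumes "recf k B" "recf (k + 2) (\<lambda>X ys. S X (ys ! 0) (ys ! 1) (drop 2 ys))" "recf k N"
  shows "recf k (\<lambda>X xs. rec_nat (B X xs) (\<lambda>i r. S X i r xs) (N X xs))"
proof -
  obtain b where b: "\<And>X xs. length xs = k \<Longrightarrow> computes X b xs (B X xs)"
    using assms(1) unfolding recf_def by blast
  obtain s where s: "\<And>X xs. length xs = k + 2 \<Longrightarrow>
      computes X s xs (S X (xs ! 0) (xs ! 1) (drop 2 xs))"
    using assms(2) unfolding recf_def by blast
  have "computes X (PrimRec b s) (n # xs) (rec_nat (B X xs) (\<lambda>i r. S X i r xs) n)"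
    if "length xs = k" for X n xs
  proof (induction n)
    case (Suc n)
    show ?case
      using computes.primrec_Suc[OF Suc] s[of "n # rec_nat (B X xs) (\<lambda>i r. S X i r xs) n # xs" X] that
      by simp
  qed (auto intro: computes.primrec_0 b that)
  \<comment> \<open>\<open>PrimRec\<close> recurses on its first argument; the function
    \<open>H\<close> of arity \<open>Suc k\<close> allows \<open>N\<close> to be substituted
    there.\<close>
  moreover define H where "H X ys = rec_nat (B X (tl ys)) (\<lambda>i r. S X i r (tl ys)) (hd ys)" for X ys
  ultimately have H: "recf (Suc k) H"
    unfolding recf_def H_def by (intro exI[of _ "PrimRec b s"]) (auto simp: length_Suc_conv)
  have "recf k (\<lambda>X xs. H X (N X xs # drop 0 xs))"
    by (rule recf_recl[OF H]) (use recl_drop_id[of k 0] assms(3) in \<open>auto intro: recl_Cons\<close>)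
  then show ?thesis
    by (simp add: H_def)
qed

text \<open>\<open>Mu\<close> needs a defined positive value at every earlier argument: totality of
  \<open>F\<close> and minimality of the least zero provide it, and \<open>ex\<close> makes the
  search end.\<close>

lemma recf_Least_eq_0:
  assumes F: "recf (k + 1) (\<lambda>X ys. F X (ys ! 0) (drop 1 ys))"
    and ex: "\<And>X xs. length xs = k \<Longrightarrow> \<exists>n. F X n xs = 0"
  shows "recf k (\<lambda>X xs. LEAST n. F X n xs = 0)"
proof -
  obtain f where f: "\<And>X xs. length xs = k + 1 \<Longrightarrow> computes X f xs (F X (xs ! 0) (drop 1 xs))"
    using F unfolding recf_def by blast
  have "computes X (Mu f) xs (LEAST n. F X n xs = 0)" if len: "length xs = k" for X xs
  proof (rule computes.mu)
    have *: "computes X f (n # xs) (F X n xs)" for n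
      using f[of "n # xs"] len by simp
    show "computes X f ((LEAST n. F X n xs = 0) # xs) 0"
      using *[of "LEAST n. F X n xs = 0"] LeastI_ex[OF ex[OF len]] by simp
    show "\<forall>m<LEAST n. F X n xs = 0. \<exists>j. computes X f (m # xs) (Suc j)"
      using * not_less_Least by (metis not0_implies_Suc)
  qed
  then show ?thesis unfolding recf_def by blast
qed

section \<open>Arithmetic, decidable predicates and bounded search\<close>

lemma recf_pred:
  assumes "recf k F"
  shows "recf k (\<lambda>X xs. F X xs - 1)"
proof (rule recf_cong)
  show "recf k (\<lambda>X xs. rec_nat 0 (\<lambda>i r. i) (F X xs))"
    by (intro recf_rec_nat recf_const recf_nth assms) simp
  show "rec_nat 0 (\<lambda>i r. i) (F X xs) = F X xs - 1" for X xs
    by (cases "F X xs") auto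
qed

lemma recf_add:
  assumes "recf k F" "recf k G"
  shows "recf k (\<lambda>X xs. F X xs + G X xs)"
proof (rule recf_comp2[OF _ assms], rule recf_cong)
  show "recf 2 (\<lambda>X xs. rec_nat (xs ! 0) (\<lambda>i r. Suc r) (xs ! 1))"
    by (intro recf_rec_nat recf_Suc recf_nth) simp_all
  have "rec_nat a (\<lambda>i r. Suc r) b = a + b" for a b :: nat
    by (induction b) auto
  then show "rec_nat (xs ! 0) (\<lambda>i r. Suc r) (xs ! 1) = xs ! 0 + xs ! 1" for xs :: "nat list" .
qed

lemma recf_diff:
  assumes "recf k F" "recf k G"
  shows "recf k (\<lambda>X xs. F X xs - G X xs)"
proof (rule recf_comp2[OF _ assms], rule recf_cong)
  show "recf 2 (\<lambda>X xs. rec_nat (xs ! 0) (\<lambda>i r. r - 1) (xs ! 1))"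
    by (intro recf_rec_nat recf_pred recf_nth) simp_all
  have "rec_nat a (\<lambda>i r. r - 1) b = a - b" for a b :: nat
    by (induction b) auto
  then show "rec_nat (xs ! 0) (\<lambda>i r. r - 1) (xs ! 1) = xs ! 0 - xs ! 1" for xs :: "nat list" .
qed

definition recp :: "nat \<Rightarrow> (cantor \<Rightarrow> nat list \<Rightarrow> bool) \<Rightarrow> bool" where
  "recp k P \<longleftrightarrow> recf k (\<lambda>X xs. of_bool (P X xs))"

lemma recf_If:
  assumes "recp k P" "recf k F" "recf k G"
  shows "recf k (\<lambda>X xs. if P X xs then F X xs else G X xs)"
proof (rule recf_cong)
  \<comment> \<open>Branching as a recursion of length 0 or 1, whose single step overwrites the
    value for \<open>False\<close>.\<close>
  show "recf k (\<lambda>X xs. rec_nat (G X xs) (\<lambda>i r. F X xs) (of_bool (P X xs)))"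
    using assms unfolding recp_def by (intro recf_rec_nat recf_drop)
qed auto

lemma recp_eq_0:
  assumes "recf k F"
  shows "recp k (\<lambda>X xs. F X xs = 0)"
  unfolding recp_def
  by (rule recf_cong[where F = "\<lambda>X xs. 1 - F X xs"])
    (auto intro: recf_diff recf_const assms)

lemma recp_not: "recp k P \<Longrightarrow> recp k (\<lambda>X xs. \<not> P X xs)"
  using recp_eq_0[of k "\<lambda>X xs. of_bool (P X xs)"] by (simp add: recp_def)

lemma recp_disj: "recp k P \<Longrightarrow> recp k Q \<Longrightarrow> recp k (\<lambda>X xs. P X xs \<or> Q X xs)"
  using recp_not[OF recp_eq_0[of k "\<lambda>X xs. of_bool (P X xs) + of_bool (Q X xs)"]]
  by (simp add: recp_def recf_add)

lemma recp_conj: "recp k P \<Longrightarrow> recp k Q \<Longrightarrow> recp k (\<lambda>X xs. P X xs \<and> Q X xs)"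
  using recp_not[OF recp_disj[OF recp_not recp_not, of k P Q]] by simp

lemma recp_le: "recf k F \<Longrightarrow> recf k G \<Longrightarrow> recp k (\<lambda>X xs. F X xs \<le> G X xs)"
  using recp_eq_0[OF recf_diff, of k F G] by simp

lemma recp_less: "recf k F \<Longrightarrow> recf k G \<Longrightarrow> recp k (\<lambda>X xs. F X xs < G X xs)"
  using recp_not[OF recp_le, of k G F] by (simp add: not_le)

lemma recp_eq: "recf k F \<Longrightarrow> recf k G \<Longrightarrow> recp k (\<lambda>X xs. F X xs = G X xs)"
  using recp_conj[OF recp_le recp_le, of k F G G F] by (simp add: order_eq_iff)

lemma recf_Least:
  assumes "recp (k + 1) (\<lambda>X ys. P X (ys ! 0) (drop 1 ys))"
    and "\<And>X xs. length xs = k \<Longrightarrow> \<exists>n. P X n xs"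
  shows "recf k (\<lambda>X xs. LEAST n. P X n xs)"
  using recf_Least_eq_0[of k "\<lambda>X n xs. of_bool (\<not> P X n xs)"] assms recp_not[OF assms(1)]
  by (simp add: recp_def)

text \<open>Stopping at \<open>N\<close> at the latest makes the search for a witness total; a
  witness below \<open>N\<close> exists exactly if the search stops earlier.\<close>

lemma recp_ex_less:
  assumes "recp (k + 1) (\<lambda>X ys. P X (ys ! 0) (drop 1 ys))" "recf k N"
  shows "recp k (\<lambda>X xs. \<exists>i<N X xs. P X i xs)"
proof -
  have "recf k (\<lambda>X xs. LEAST i. N X xs \<le> i \<or> P X i xs)"
    by (intro recf_Least recp_disj recp_le assms recf_drop recf_nth) auto
  with assms(2) have "recp k (\<lambda>X xs. (LEAST i. N X xs \<le> i \<or> P X i xs) < N X xs)"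
    by (intro recp_less)
  moreover have "(LEAST i. n \<le> i \<or> Q i) < n \<longleftrightarrow> (\<exists>i<n. Q i)" for n and Q :: "nat \<Rightarrow> bool"
    using LeastI[of "\<lambda>i. n \<le> i \<or> Q i" n] Least_le[of "\<lambda>i. n \<le> i \<or> Q i"]
    by (metis le_less_trans linorder_not_less order_refl)
  ultimately show ?thesis by simp
qed

lemma recp_all_less:
  assumes "recp (k + 1) (\<lambda>X ys. P X (ys ! 0) (drop 1 ys))" "recf k N"
  shows "recp k (\<lambda>X xs. \<forall>i<N X xs. P X i xs)"
  using recp_not[OF recp_ex_less[OF recp_not[OF assms(1)] assms(2)]] by simp

lemmas recf_intros = recf_nth recf_drop_nth recf_drop_drop_nth recf_drop_drop_drop_nth
  recf_Suc recf_query recf_const recf_rec_nat recf_add recf_diff recf_If recp_not recp_disj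
  recp_conj recp_le recp_less recp_eq recf_Least recp_ex_less recp_all_less

lemma recf_max: "recf k F \<Longrightarrow> recf k G \<Longrightarrow> recf k (\<lambda>X xs. max (F X xs) (G X xs))"
  unfolding max_def by (intro recf_intros)

lemma recf_div_2:
  assumes "recf k F"
  shows "recf k (\<lambda>X xs. F X xs div 2)"
proof (rule recf_comp1[OF _ assms], rule recf_cong)
  \<comment> \<open>Halving as a search that uses additions only.\<close>
  show "recf 1 (\<lambda>X xs. LEAST q. xs ! 0 < q + q + 2)"
  proof (intro recf_intros)
    show "\<exists>q. xs ! 0 < q + q + 2" for xs :: "nat list"
      by (rule exI[of _ "xs ! 0"]) simp
  qed simp_all
  have "(LEAST q. n < q + q + 2) = n div 2" for n :: nat
    by (rule Least_equality) linarith+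
  then show "(LEAST q. xs ! 0 < q + q + 2) = xs ! 0 div 2" for xs :: "nat list" .
qed

text \<open>The codes \<open>n\<close> of strings of length \<open>l\<close> are those with 2^l
  \<le> n + 1 < 2^(l + 1), so the length is found by a search through powers, obtained by
  doubling.\<close>

lemma recf_length_str_decode:
  assumes "recf k F"
  shows "recf k (\<lambda>X xs. length (str_decode (F X xs)))"
proof (rule recf_comp1[OF _ assms], rule recf_cong)
  define pow :: "nat \<Rightarrow> nat" where "pow l = rec_nat 1 (\<lambda>i r. r + r) l" for l
  have pow: "pow l = 2 ^ l" for l
    unfolding pow_def by (induction l) auto
  have rec_pow: "recf k (\<lambda>X xs. pow (G X xs))" if "recf k G" for k G
    unfolding pow_def using that by (intro recf_intros) auto
  show "recf 1 (\<lambda>X xs. LEAST l. xs ! 0 + 1 < pow (Suc l))"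
  proof (intro recf_intros rec_pow)
    show "\<exists>l. xs ! 0 + 1 < pow (Suc l)" for xs :: "nat list"
      unfolding pow by (rule exI[of _ "xs ! 0"]) (metis Suc_eq_plus1 less_exp)
  qed simp_all
  have "(LEAST l. n + 1 < pow (Suc l)) = length (str_decode n)" for n
  proof (rule Least_equality)
    show "n + 1 < pow (Suc (length (str_decode n)))"
      using str_code_bounds[of "str_decode n"] unfolding pow by simp
    fix l assume "n + 1 < pow (Suc l)"
    then have "(2::nat) ^ length (str_decode n) < 2 ^ Suc l"
      using str_code_bounds[of "str_decode n"] unfolding pow str_code_decode by linarith
    then show "length (str_decode n) \<le> l"
      by (simp del: power_Suc)
  qed
  then show "(LEAST l. xs ! 0 + 1 < pow (Suc l)) = length (str_decode (xs ! 0))"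
    for xs :: "nat list" .
qed

section \<open>Evaluation with bounded search\<close>

text \<open>The result is \<open>0\<close> if no value is found, and \<open>Suc y\<close> if the value is \<open>y\<close>. The stage \<open>t\<close> bounds
  only the search of \<open>Mu\<close>, which suffices for totality.\<close>

fun eval_upto :: "cantor \<Rightarrow> nat \<Rightarrow> prog \<Rightarrow> nat list \<Rightarrow> nat" where
  "eval_upto X t Zero xs = 1"
| "eval_upto X t Succ xs = (if length xs = 1 then Suc (Suc (xs ! 0)) else 0)"
| "eval_upto X t Query xs = (if length xs = 1 then Suc (of_bool (X (xs ! 0))) else 0)"
| "eval_upto X t (Proj i) xs = (if i < length xs then Suc (xs ! i) else 0)"
| "eval_upto X t (Comp f gs) xs = (if 0 \<in> set (map (\<lambda>g. eval_upto X t g xs) gs) then 0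
    else eval_upto X t f (map (\<lambda>g. eval_upto X t g xs - 1) gs))"
| "eval_upto X t (PrimRec f g) xs = (case xs of [] \<Rightarrow> 0 | n # zs \<Rightarrow> rec_nat (eval_upto X t f zs)
    (\<lambda>i r. if r = 0 then 0 else eval_upto X t g (i # (r - 1) # zs)) n)"
| "eval_upto X t (Mu f) xs = (let n = LEAST n. t \<le> n \<or> eval_upto X t f (n # xs) \<le> 1
    in if n < t \<and> eval_upto X t f (n # xs) = 1 then Suc n else 0)"

declare eval_upto.simps(5-7) [simp del]

lemma eval_upto_PrimRec [simp]:
  "eval_upto X t (PrimRec f g) [] = 0"
  "eval_upto X t (PrimRec f g) (0 # xs) = eval_upto X t f xs"
  by (simp_all add: eval_upto.simps(6))

lemma eval_upto_PrimRec_Suc_iff: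
  "eval_upto X t (PrimRec f g) (Suc n # xs) = Suc y \<longleftrightarrow>
    (\<exists>r. eval_upto X t (PrimRec f g) (n # xs) = Suc r \<and> eval_upto X t g (n # r # xs) = Suc y)"
proof -
  have "eval_upto X t (PrimRec f g) (Suc n # xs) = (if eval_upto X t (PrimRec f g) (n # xs) = 0 then 0
      else eval_upto X t g (n # (eval_upto X t (PrimRec f g) (n # xs) - 1) # xs))"
    by (simp add: eval_upto.simps(6))
  then show ?thesis
    by (cases "eval_upto X t (PrimRec f g) (n # xs)") auto
qed

lemma eval_upto_Comp_iff:
  "eval_upto X t (Comp f gs) xs = Suc z \<longleftrightarrow>
    (\<exists>ys. list_all2 (\<lambda>g y. eval_upto X t g xs = Suc y) gs ys \<and> eval_upto X t f ys = Suc z)"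
proof -
  \<comment> \<open>Success of all components determines \<open>ys\<close>, so the existential
    quantifier collapses.\<close>
  have "list_all2 (\<lambda>g y. eval_upto X t g xs = Suc y) gs ys \<longleftrightarrow>
      0 \<notin> set (map (\<lambda>g. eval_upto X t g xs) gs) \<and> ys = map (\<lambda>g. eval_upto X t g xs - 1) gs" for ys
  proof (induction gs arbitrary: ys)
    case (Cons g gs)
    then show ?case by (cases ys; cases "eval_upto X t g xs") auto
  qed simp
  then show ?thesis by (simp add: eval_upto.simps(5) cong: conj_cong)
qed

text \<open>With results shifted by one, 0 means failure and 1 the value 0. The search halts at the
  first result that is at most 1 and accepts only 1, just as \<open>mu\<close> wants earlier values
  to be defined and positive.\<close>

lemma eval_upto_Mu_iff:
  "eval_upto X t (Mu f) xs = Suc n \<longleftrightarrow>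
    n < t \<and> eval_upto X t f (n # xs) = 1 \<and> (\<forall>m<n. 1 < eval_upto X t f (m # xs))"
  (is "?L \<longleftrightarrow> ?R")
proof
  let ?P = "\<lambda>n. t \<le> n \<or> eval_upto X t f (n # xs) \<le> 1"
  show ?R if ?L
    using that not_less_Least[of _ ?P] by (auto simp: eval_upto.simps(7) Let_def not_le split: if_splits)
  assume R: ?R
  then have "(LEAST n. ?P n) = n"
    by (intro Least_equality) (auto, meson not_le less_trans)
  with R show ?L by (simp add: eval_upto.simps(7) Let_def)
qed

text \<open>Soundness at a single stage, by induction on the program; \<open>PrimRec\<close> needs
  an inner induction on the recursion argument.\<close>

lemma computes_if_eval_upto: "eval_upto X t e xs = Suc y \<Longrightarrow> computes X e xs y"
proof (induction e arbitrary: xs y)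
  case (Comp f gs)
  then obtain ys where ys: "list_all2 (\<lambda>g y. eval_upto X t g xs = Suc y) gs ys" "eval_upto X t f ys = Suc y"
    by (auto simp: eval_upto_Comp_iff)
  from ys(1) Comp.IH(2) have "list_all2 (\<lambda>g y. computes X g xs y) gs ys"
    by (auto simp: list_all2_conv_all_nth)
  with Comp.IH(1) ys(2) show ?case by (blast intro: computes.comp)
next
  case (PrimRec f g)
  then obtain n zs where xs: "xs = n # zs" by (cases xs) auto
  have "eval_upto X t (PrimRec f g) (n # zs) = Suc y \<Longrightarrow> computes X (PrimRec f g) (n # zs) y"
  proof (induction n arbitrary: y)
    case 0
    with PrimRec show ?case by (auto intro: computes.primrec_0)
  next
    case (Suc n)
    then obtain r where "eval_upto X t (PrimRec f g) (n # zs) = Suc r" "eval_upto X t g (n # r # zs) = Suc y"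
      by (auto simp: eval_upto_PrimRec_Suc_iff)
    with Suc.IH PrimRec.IH(2) show ?case by (blast intro: computes.primrec_Suc)
  qed
  with PrimRec.prems xs show ?case by blast
next
  case (Mu f)
  then have "eval_upto X t f (y # xs) = Suc 0" and m: "\<forall>m<y. 1 < eval_upto X t f (m # xs)"
    by (auto simp: eval_upto_Mu_iff)
  moreover have "\<exists>k. computes X f (m # xs) (Suc k)" if "m < y" for m
  proof -
    from m that have "1 < eval_upto X t f (m # xs)" by blast
    then obtain k where "eval_upto X t f (m # xs) = Suc (Suc k)"
      by (auto simp: less_iff_Suc_add)
    with Mu.IH show ?thesis by blast
  qed
  ultimately show ?case using Mu.IH by (blast intro: computes.mu)
next
  case Query
  then obtain x where "xs = [x]" "y = of_bool (X x)"
    by (auto split: if_splits simp: length_Suc_conv)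
  then show ?case by (simp only: computes.query)
qed (auto split: if_splits simp: length_Suc_conv intro: computes.intros)

text \<open>Completeness at all late stages, not just at some stage: finitely many subcomputations
  then share a stage without any appeal to monotonicity in \<open>t\<close>.\<close>

lemma eventually_eval_upto_if_computes:
  "computes X e xs y \<Longrightarrow> eventually (\<lambda>t. eval_upto X t e xs = Suc y) at_top"
proof (induction rule: computes.induct)
  case (comp xs gs ys f z)
  have "eventually (\<lambda>t. list_all2 (\<lambda>g y. eval_upto X t g xs = Suc y) gs ys) at_top"
    using comp.IH(1) by (induction rule: list_all2_induct) (auto intro: eventually_conj)
  with comp.IH(2) show ?case
    by eventually_elim (auto simp: eval_upto_Comp_iff)
next
  case (primrec_Suc f g n xs r y)
  from primrec_Suc.IH show ?case
    by eventually_elim (auto simp: eval_upto_PrimRec_Suc_iff)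
next
  case (mu f n xs)
  have "eventually (\<lambda>t. \<forall>m\<in>{..<n}. 1 < eval_upto X t f (m # xs)) at_top"
  proof (rule eventually_ball_finite)
    show "\<forall>m\<in>{..<n}. eventually (\<lambda>t. 1 < eval_upto X t f (m # xs)) at_top"
    proof
      fix m assume "m \<in> {..<n}"
      then obtain k where "eventually (\<lambda>t. eval_upto X t f (m # xs) = Suc (Suc k)) at_top"
        using mu.IH(2) by auto
      then show "eventually (\<lambda>t. 1 < eval_upto X t f (m # xs)) at_top"
        by eventually_elim simp
    qed
  qed simp
  with mu.IH(1) eventually_gt_at_top[of n] show ?case
    by eventually_elim (auto simp: eval_upto_Mu_iff)
qed auto

lemma computes_iff_eventually_eval_upto:
  "computes X e xs y \<longleftrightarrow> eventually (\<lambda>t. eval_upto X t e xs = Suc y) at_top"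
  using eventually_eval_upto_if_computes
  by (auto intro: computes_if_eval_upto simp: eventually_sequentially)

lemma computes_functional: "computes X e xs y \<Longrightarrow> computes X e xs z \<Longrightarrow> y = z"
proof -
  assume "computes X e xs y" "computes X e xs z"
  then have "eventually (\<lambda>t. eval_upto X t e xs = Suc y \<and> eval_upto X t e xs = Suc z) at_top"
    by (simp add: computes_iff_eventually_eval_upto eventually_conj)
  then show ?thesis by (auto simp: eventually_sequentially)
qed

text \<open>The program is fixed, so induction on it suffices and no coding of programs is involved.
  Stage and arguments are arbitrary recursive functions, so that evaluation can occur inside
  searches.\<close>

lemma recf_eval_upto:
  "recf m T \<Longrightarrow> recl m k L \<Longrightarrow> recf m (\<lambda>X xs. eval_upto X (T X xs) e (L X xs))"
proof (induction e arbitrary: m k T L)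
  case Zero
  show ?case by (simp add: recf_const)
next
  case Succ
  \<comment> \<open>\<open>L X xs\<close> always has length \<open>k\<close>, so the arity test of
    \<open>eval_upto\<close> is settled once and for all.\<close>
  show ?case
  proof (cases "k = 1")
    case True
    with Succ have "recf m (\<lambda>X xs. Suc (Suc (L X xs ! 0)))"
      by (intro recf_Suc recf_recl_nth[where k = k]) simp_all
    then show ?thesis
      by (rule recf_cong) (use True Succ recl_length in auto)
  next
    case False
    show ?thesis
      by (rule recf_cong[OF recf_const[of m 0]]) (use False Succ recl_length in auto)
  qed
next
  case Query
  show ?case
  proof (cases "k = 1")
    case True
    with Query have "recf m (\<lambda>X xs. Suc (of_bool (X (L X xs ! 0))))"
      by (intro recf_Suc recf_query recf_recl_nth[where k = k]) simp_all
    then show ?thesis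
      by (rule recf_cong) (use True Query recl_length in auto)
  next
    case False
    show ?thesis
      by (rule recf_cong[OF recf_const[of m 0]]) (use False Query recl_length in auto)
  qed
next
  case (Proj i)
  show ?case
  proof (cases "i < k")
    case True
    with Proj have "recf m (\<lambda>X xs. Suc (L X xs ! i))"
      by (intro recf_Suc recf_recl_nth[where k = k]) simp_all
    then show ?thesis
      by (rule recf_cong) (use True Proj recl_length in auto)
  next
    case False
    show ?thesis
      by (rule recf_cong[OF recf_const[of m 0]]) (use False Proj recl_length in auto)
  qed
next
  case (Comp f gs)
  have gs: "recf m (\<lambda>X xs. eval_upto X (T X xs) g (L X xs))" if "g \<in> set gs" for g
    using Comp that by blast
  have "recp m (\<lambda>X xs. \<exists>g\<in>set gs. eval_upto X (T X xs) g (L X xs) = 0)"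
    using gs
  proof (induction gs)
    case Nil
    show ?case by (simp add: recp_def recf_const)
  next
    case (Cons g gs)
    then show ?case by (auto intro!: recp_disj recp_eq_0)
  qed
  moreover have "recl m (length gs) (\<lambda>X xs. map (\<lambda>g. eval_upto X (T X xs) g (L X xs) - 1) gs)"
    by (rule recl_map, rule recf_pred, rule gs)
  then have "recf m (\<lambda>X xs. eval_upto X (T X xs) f (map (\<lambda>g. eval_upto X (T X xs) g (L X xs) - 1) gs))"
    by (rule Comp.IH(1)[OF Comp.prems(1)])
  ultimately have "recf m (\<lambda>X xs. if \<exists>g\<in>set gs. eval_upto X (T X xs) g (L X xs) = 0 then 0
      else eval_upto X (T X xs) f (map (\<lambda>g. eval_upto X (T X xs) g (L X xs) - 1) gs))"
    by (intro recf_If recf_const)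
  then show ?case
    by (rule recf_cong) (auto simp: eval_upto.simps(5) image_iff)
next
  case (PrimRec f g)
  show ?case
  proof (cases k)
    case 0
    show ?thesis
      by (rule recf_cong[OF recf_const[of m 0]])
        (use 0 PrimRec.prems(2) recl_length in \<open>fastforce simp: eval_upto.simps(6)\<close>)
  next
    case (Suc k')
    have tl: "recl m k' (\<lambda>X xs. tl (L X xs))"
      using PrimRec.prems(2) Suc by (auto intro: recl_tl)
    have "recf m (\<lambda>X xs. L X xs ! 0)"
      using PrimRec.prems(2) Suc by (simp add: recf_recl_nth)
    with tl have "recf m (\<lambda>X xs. rec_nat (eval_upto X (T X xs) f (tl (L X xs)))
        (\<lambda>i r. if r = 0 then 0 else eval_upto X (T X xs) g (i # (r - 1) # tl (L X xs))) (L X xs ! 0))"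
      by (intro recf_rec_nat PrimRec.IH(1)[where k = k'] PrimRec.IH(2)[where k = "Suc (Suc k')"]
          recf_If recp_eq recf_const recf_nth recl_Cons recf_diff recf_drop PrimRec.prems(1)
          recl_drop[where L = "\<lambda>X xs. tl (L X xs)"]) auto
    then show ?thesis
    proof (rule recf_cong)
      fix X :: cantor and xs :: "nat list"
      assume "length xs = m"
      then obtain n zs where "L X xs = n # zs"
        using recl_length[OF PrimRec.prems(2)] Suc by (metis length_Suc_conv)
      then show "rec_nat (eval_upto X (T X xs) f (tl (L X xs)))
          (\<lambda>i r. if r = 0 then 0 else eval_upto X (T X xs) g (i # (r - 1) # tl (L X xs))) (L X xs ! 0) =
        eval_upto X (T X xs) (PrimRec f g) (L X xs)"
        by (simp only: eval_upto.simps(6) list.sel list.case nth_Cons_0)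
    qed
  qed
next
  case (Mu f)
  let ?P = "\<lambda>X n xs. T X xs \<le> n \<or> eval_upto X (T X xs) f (n # L X xs) \<le> 1"
  have min: "recf m (\<lambda>X xs. LEAST n. ?P X n xs)"
    using Mu.prems
    by (intro recf_Least recp_disj recp_le Mu.IH[where k = "Suc k"] recf_drop recl_Cons recl_drop recf_nth recf_const)
      auto
  with Mu.prems have "recf m (\<lambda>X xs. if (LEAST n. ?P X n xs) < T X xs \<and>
      eval_upto X (T X xs) f ((LEAST n. ?P X n xs) # L X xs) = 1 then Suc (LEAST n. ?P X n xs) else 0)"
    by (intro recf_If recp_conj recp_less recp_eq recf_Suc recf_const Mu.IH[where k = "Suc k"] recl_Cons)
  then show ?case
    by (simp only: eval_upto.simps(7) Let_def)
qed

section \<open>Removing oracle queries\<close>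

fun no_query :: "prog \<Rightarrow> prog" where
  \<comment> \<open>\<open>Zero\<close> alone would also halt on lists that are not of length 1.\<close>
  "no_query Query = Comp Zero [Succ]"
| "no_query (Comp f gs) = Comp (no_query f) (map no_query gs)"
| "no_query (PrimRec f g) = PrimRec (no_query f) (no_query g)"
| "no_query (Mu f) = Mu (no_query f)"
| "no_query e = e"

lemma eval_upto_no_query: "eval_upto X t (no_query e) xs = eval_upto empty_real t e xs"
proof (induction e arbitrary: xs)
  case (Comp f gs)
  then show ?case by (simp add: eval_upto.simps(5) comp_def cong: map_cong)
next
  case (PrimRec f g)
  then have "eval_upto X t (no_query f) = eval_upto empty_real t f" "eval_upto X t (no_query g) = eval_upto empty_real t g"
    by blast+
  then show ?case by (simp only: no_query.simps eval_upto.simps(6))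
qed (auto simp: eval_upto.simps(5,7))

text \<open>Lets an oracle-free computation run inside one with oracle \<open>X\<close>; queries to
  the empty set are answered by the constant 0.\<close>

lemma computes_no_query: "computes X (no_query e) xs y \<longleftrightarrow> computes empty_real e xs y"
  by (simp add: computes_iff_eventually_eval_upto eval_upto_no_query)

lemma recf_eval_upto_empty:
  "recf m T \<Longrightarrow> recl m k L \<Longrightarrow> recf m (\<lambda>X xs. eval_upto empty_real (T X xs) e (L X xs))"
  using recf_eval_upto[of m T k L "no_query e"] by (simp add: eval_upto_no_query)

text \<open>The hierarchy is defined with the empty oracle; \<open>no_query\<close> makes its
  programs work uniformly in every oracle.\<close>

lemma recursive_rel_iff: "recursive_rel k R \<longleftrightarrow> recp k (\<lambda>X. R)"
  unfolding recursive_rel_def recp_def recf_def by (metis computes_no_query)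

lemma recp_recl: "recp k P \<Longrightarrow> recl m k L \<Longrightarrow> recp m (\<lambda>X xs. P X (L X xs))"
  unfolding recp_def by (rule recf_recl)

section \<open>Limit computability\<close>

text \<open>The notion of the limit lemma; the first argument of \<open>G\<close> is the
  stage.\<close>

definition limit_computable :: "(nat \<Rightarrow> nat) \<Rightarrow> bool" where
  "limit_computable g \<longleftrightarrow> (\<exists>G. recf 2 (\<lambda>X xs. G (xs ! 0) (xs ! 1)) \<and>
    (\<forall>n. eventually (\<lambda>t. G t n = g n) at_top))"

text \<open>The easy half of the limit lemma: a value is the limit iff it is taken from some stage
  on, and iff it is taken at arbitrarily late stages. These are the \<open>Sigma2\<close> and the
  \<open>Pi2\<close> form.\<close>

lemma Delta2_fun_if_limit_computable:
  assumes "limit_computable g"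
  shows "Delta2_fun g"
proof -
  obtain G where G: "recf 2 (\<lambda>X xs. G (xs ! 0) (xs ! 1))"
    and lim: "\<And>n. \<exists>t0. \<forall>t\<ge>t0. G t n = g n"
    using assms unfolding limit_computable_def eventually_sequentially by blast
  \<comment> \<open>In \<open>x # y # xs\<close>, position 0 is a lower bound on the stage, 1 the
    stage, 2 the argument and 3 the candidate value.\<close>
  have rG: "recf 4 (\<lambda>X xs. G (xs ! 1) (xs ! 2))"
    by (rule recf_comp2[OF G]; rule recf_nth) simp_all
  have "Sigma2 2 (\<lambda>xs. g (xs ! 0) = xs ! 1)"
    unfolding Sigma2_def
  proof (intro exI[of _ "\<lambda>xs. xs ! 1 < xs ! 0 \<or> G (xs ! 1) (xs ! 2) = xs ! 3"] conjI allI impI)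
    show "recursive_rel (2 + 2) (\<lambda>xs. xs ! 1 < xs ! 0 \<or> G (xs ! 1) (xs ! 2) = xs ! 3)"
      unfolding recursive_rel_iff using rG by (intro recp_disj recp_less recp_eq recf_nth) simp_all
    fix xs :: "nat list"
    obtain t0 where t0: "\<forall>t\<ge>t0. G t (xs ! 0) = g (xs ! 0)" using lim by blast
    have "(\<exists>x. \<forall>y\<ge>x. G y (xs ! 0) = xs ! 1) \<longleftrightarrow> g (xs ! 0) = xs ! 1"
      using t0 by (metis nle_le)
    then show "g (xs ! 0) = xs ! 1 \<longleftrightarrow> (\<exists>x. \<forall>y. (x # y # xs) ! 1 < (x # y # xs) ! 0 \<or>
        G ((x # y # xs) ! 1) ((x # y # xs) ! 2) = (x # y # xs) ! 3)"
      by (simp add: numeral_2_eq_2 numeral_3_eq_3 not_less[symmetric] imp_conv_disj)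
  qed
  moreover have "Pi2 2 (\<lambda>xs. g (xs ! 0) = xs ! 1)"
    unfolding Pi2_def
  proof (intro exI[of _ "\<lambda>xs. xs ! 0 \<le> xs ! 1 \<and> G (xs ! 1) (xs ! 2) = xs ! 3"] conjI allI impI)
    show "recursive_rel (2 + 2) (\<lambda>xs. xs ! 0 \<le> xs ! 1 \<and> G (xs ! 1) (xs ! 2) = xs ! 3)"
      unfolding recursive_rel_iff using rG by (intro recp_conj recp_le recp_eq recf_nth) simp_all
    fix xs :: "nat list"
    obtain t0 where t0: "\<forall>t\<ge>t0. G t (xs ! 0) = g (xs ! 0)" using lim by blast
    have "(\<forall>x. \<exists>y\<ge>x. G y (xs ! 0) = xs ! 1) \<longleftrightarrow> g (xs ! 0) = xs ! 1"
      using t0 by (metis nle_le)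
    then show "g (xs ! 0) = xs ! 1 \<longleftrightarrow> (\<forall>x. \<exists>y. (x # y # xs) ! 0 \<le> (x # y # xs) ! 1 \<and>
        G ((x # y # xs) ! 1) ((x # y # xs) ! 2) = (x # y # xs) ! 3)"
      by (simp add: numeral_2_eq_2 numeral_3_eq_3)
  qed
  ultimately show ?thesis
    unfolding Delta2_fun_def Delta2_def by blast
qed

text \<open>The other half, for sets: \<open>A n\<close> and its negation both have a
  \<open>Sigma2\<close> form, so some \<open>x\<close> is a true witness for one of them. The false
  candidates below the least true one are refuted at finite stages, and the guess settles on
  it.\<close>

lemma Delta2_real_approximation:
  assumes "Delta2_real A"
  obtains G where "recp 2 (\<lambda>X xs. G (xs ! 0) (xs ! 1))"
    "\<And>n. eventually (\<lambda>t. G t n = A n) at_top"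
proof -
  obtain R where R: "recp (Suc (Suc (Suc 0))) (\<lambda>X. R)"
    and AR: "\<forall>xs. length xs = 1 \<longrightarrow> (A (xs ! 0) \<longleftrightarrow> (\<exists>x. \<forall>y. R (x # y # xs)))"
    using assms unfolding Delta2_real_def Delta2_def Sigma2_def recursive_rel_iff
    by (auto simp: numeral_3_eq_3)
  obtain S where S: "recp (Suc (Suc (Suc 0))) (\<lambda>X. S)"
    and AS: "\<forall>xs. length xs = 1 \<longrightarrow> (A (xs ! 0) \<longleftrightarrow> (\<forall>x. \<exists>y. S (x # y # xs)))"
    using assms unfolding Delta2_real_def Delta2_def Pi2_def recursive_rel_iff
    by (auto simp: numeral_3_eq_3)
  define P where "P t x n \<longleftrightarrow> (\<forall>y<t. R [x, y, n])" for t x n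
  define N where "N t x n \<longleftrightarrow> (\<forall>y<t. \<not> S [x, y, n])" for t x n
  \<comment> \<open>The least \<open>x\<close> that still looks like a witness for \<open>n \<in> A\<close> or for \<open>n \<notin> A\<close> at stage \<open>t\<close>.\<close>
  define w where "w t n = (LEAST x. t \<le> x \<or> P t x n \<or> N t x n)" for t n
  show thesis
  proof (rule that[of "\<lambda>t n. P t (w t n) n"])
    show "recp 2 (\<lambda>X xs. P (xs ! 0) (w (xs ! 0) (xs ! 1)) (xs ! 1))"
      unfolding w_def P_def N_def
      by (intro recp_all_less recp_recl[OF R] recp_recl[OF S] recl_Cons recl_Nil recf_Least
          recp_not recp_disj recp_le recf_nth recf_drop_nth recf_drop_drop_nth
          recf_drop_drop_drop_nth) auto
    fix n
    have An: "A n \<longleftrightarrow> (\<exists>x. \<forall>y. R [x, y, n])" "\<not> A n \<longleftrightarrow> (\<exists>x. \<forall>y. \<not> S [x, y, n])"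
      using AR[rule_format, of "[n]"] AS[rule_format, of "[n]"] by auto
    let ?W = "\<lambda>x. (\<forall>y. R [x, y, n]) \<or> (\<forall>y. \<not> S [x, y, n])"
    define x0 where "x0 = (LEAST x. ?W x)"
    have x0: "?W x0"
      unfolding x0_def by (rule LeastI_ex) (use An in blast)
    have "eventually (\<lambda>t. \<forall>x\<in>{..<x0}. \<not> P t x n \<and> \<not> N t x n) at_top"
    proof (rule eventually_ball_finite)
      show "\<forall>x\<in>{..<x0}. eventually (\<lambda>t. \<not> P t x n \<and> \<not> N t x n) at_top"
      proof
        fix x assume "x \<in> {..<x0}"
        then have "\<not> ?W x" unfolding x0_def using not_less_Least by blast
        then obtain y y' where "\<not> R [x, y, n]" "S [x, y', n]" by blast
        with eventually_gt_at_top[of "max y y'"]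
        show "eventually (\<lambda>t. \<not> P t x n \<and> \<not> N t x n) at_top"
          unfolding P_def N_def by (auto elim!: eventually_mono)
      qed
    qed simp
    \<comment> \<open>Once \<open>t\<close> exceeds \<open>x0\<close>, the bound
      \<open>t \<le> x\<close> that keeps the search total no longer stops it early.\<close>
    then have w: "eventually (\<lambda>t. w t n = x0) at_top"
      using eventually_gt_at_top[of x0]
    proof eventually_elim
      case (elim t)
      show ?case
        unfolding w_def
      proof (rule Least_equality)
        show "t \<le> x0 \<or> P t x0 n \<or> N t x0 n" using x0 by (auto simp: P_def N_def)
        show "x0 \<le> x" if "t \<le> x \<or> P t x n \<or> N t x n" for x
          by (rule ccontr) (use that elim in \<open>auto simp: not_le\<close>)
      qed
    qed
    show "eventually (\<lambda>t. P t (w t n) n = A n) at_top"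
    proof (cases "A n")
      case True
      with An x0 have "\<forall>y. R [x0, y, n]" by blast
      with w True show ?thesis
        by (auto simp: P_def elim!: eventually_mono)
    next
      case False
      \<comment> \<open>Here \<open>x0\<close> witnesses non-membership, and the guess is right as
        soon as a counterexample \<open>y\<close> to \<open>R\<close> lies below
        \<open>t\<close>.\<close>
      with An obtain y where y: "\<not> R [x0, y, n]" by blast
      from w eventually_gt_at_top[of y] show ?thesis
        by eventually_elim (use y False in \<open>auto simp: P_def\<close>)
    qed
  qed
qed

section \<open>Initial segments and running maxima\<close>

lemma restr_Suc: "restr B (Suc n) = restr B n @ [B n]"
  by (simp add: restr_def)

lemma length_restr [simp]: "length (restr B n) = n"
  by (simp add: restr_def)

lemma replicate_False_eq_restr: "replicate n False = restr empty_real n"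
  by (simp add: restr_def map_replicate_const)

text \<open>A Horner scheme with additions and queries to \<open>B\<close> only, so that
  \<open>recf_rec_nat\<close> applies.\<close>

lemma str_code_restr:
  "str_code (restr B n) = rec_nat 0 (\<lambda>i r. r + r + 1 + of_bool (B i)) n"
  by (induction n) (simp_all add: restr_Suc, simp add: restr_def)

lemma restr_cong: "(\<And>m. m < n \<Longrightarrow> B m = C m) \<Longrightarrow> restr B n = restr C n"
  by (simp add: restr_def)

text \<open>Recursion in place of \<open>Max\<close> fits \<open>recf_rec_nat\<close>;
  \<open>runmax_eq_Max\<close> recovers the order properties.\<close>

definition runmax :: "(nat \<Rightarrow> nat) \<Rightarrow> nat \<Rightarrow> nat" where
  "runmax h = rec_nat (h 0) (\<lambda>i r. max r (h (Suc i)))"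

lemma runmax_simps [simp]: "runmax h 0 = h 0" "runmax h (Suc n) = max (runmax h n) (h (Suc n))"
  by (simp_all add: runmax_def)

lemma runmax_eq_Max: "runmax h n = Max (h ` {..n})"
  by (induction n) (simp_all add: atMost_Suc max.commute)

lemma le_runmax: "m \<le> n \<Longrightarrow> h m \<le> runmax h n"
  by (simp add: runmax_eq_Max)

lemma mono_runmax: "mono (runmax h)"
  by (rule mono_iff_le_Suc[THEN iffD2]) simp

text \<open>Supplies arguments at which \<open>h\<close> equals its own running maximum, so that
  half of the latter falls far short of \<open>h\<close>.\<close>

lemma runmax_attained: "\<exists>m\<le>n. h m = runmax h n \<and> runmax h m = runmax h n"
proof -
  have "runmax h n \<in> h ` {..n}"
    unfolding runmax_eq_Max by (rule Max_in) auto
  then obtain m where m: "m \<le> n" "h m = runmax h n" by auto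
  with le_runmax[of m m h] monoD[OF mono_runmax, of m n h] have "runmax h m = runmax h n"
    by simp
  with m show ?thesis by blast
qed

lemma runmax_cong: "(\<And>m. m \<le> n \<Longrightarrow> h m = h' m) \<Longrightarrow> runmax h n = runmax h' n"
  by (simp add: runmax_eq_Max)

lemma mono_length_str_decode: "mono (\<lambda>n. length (str_decode n))"
proof (rule monoI)
  fix m n :: nat
  assume "m \<le> n"
  then have "(2::nat) ^ length (str_decode m) < 2 ^ (length (str_decode n) + 1)"
    using str_code_bounds[of "str_decode m"] str_code_bounds[of "str_decode n"]
    unfolding str_code_decode by linarith
  then show "length (str_decode m) \<le> length (str_decode n)"
    by (simp del: power_Suc add: less_Suc_eq_le)
qed

section \<open>Kolmogorov complexity\<close>

lemma KX_le: "U X p = Some s \<Longrightarrow> KX U X s \<le> length p"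
  unfolding KX_def by (rule Least_le) blast

lemma KX_attained: "U X p = Some s \<Longrightarrow> \<exists>q. U X q = Some s \<and> length q = KX U X s"
  unfolding KX_def by (rule LeastI_ex) blast

text \<open>Ensures that the \<open>LEAST\<close> in \<open>KX\<close> ranges over a nonempty set.
  \<open>U\<close> simulates a machine whose only program is the empty string, with output
  \<open>s\<close>.\<close>

lemma universal_machine_onto:
  assumes "universal_machine U"
  shows "\<exists>p. U X p = Some s"
proof -
  define M :: machine where "M X p = (if p = [] then Some s else None)" for X p
  obtain c where c: "\<And>X xs. length xs = 1 \<Longrightarrow> computes X c xs (str_code s)"
    using recf_const[of 1 "str_code s"] unfolding recf_def by blast
  \<comment> \<open>The search tests \<open>x\<close> itself at every \<open>n\<close>: it returns 0
    at once if \<open>x = 0\<close>, the code of the empty string, and diverges otherwise.\<close>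
  have "eval_upto X t (Mu (Proj (Suc 0))) [x] = Suc n \<longleftrightarrow> n < t \<and> n = 0 \<and> x = 0" for X t x n
    unfolding eval_upto_Mu_iff by auto
  then have Mu: "computes X (Mu (Proj (Suc 0))) [x] n \<longleftrightarrow> n = 0 \<and> x = 0" for X x n
    by (auto simp: computes_iff_eventually_eval_upto eventually_sequentially intro: exI[of _ 1])
  have "M X p = Some q \<longleftrightarrow> computes X (Comp c [Mu (Proj (Suc 0))]) [str_code p] (str_code q)" for X p q
  proof
    assume "M X p = Some q"
    then have "p = []" "q = s" by (auto simp: M_def split: if_splits)
    then show "computes X (Comp c [Mu (Proj (Suc 0))]) [str_code p] (str_code q)"
      using c by (auto intro!: computes.comp[where ys = "[0]"] simp: Mu)
  next
    assume "computes X (Comp c [Mu (Proj (Suc 0))]) [str_code p] (str_code q)"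
    then obtain ys where "list_all2 (\<lambda>g y. computes X g [str_code p] y) [Mu (Proj (Suc 0))] ys"
      and q: "computes X c ys (str_code q)"
      by (cases rule: computes.cases) auto
    then have ys: "ys = [0]" and p: "str_code p = str_code []"
      by (auto simp: list_all2_Cons1 Mu)
    from q c[of ys X] ys have "str_code q = str_code s"
      by (auto dest: computes_functional)
    with p show "M X p = Some q"
      using inj_str_code by (simp only: M_def inj_eq) simp
  qed
  then have "computable_machine M"
    unfolding computable_machine_def by blast
  then have "prefix_free_machine M"
    unfolding prefix_free_machine_def prefix_free_def by (auto simp: M_def split: if_splits)
  then obtain r where "\<And>X p. U X (r @ p) = M X p"
    using assms unfolding universal_machine_def by blast
  from this[of X "[]"] show ?thesis by (auto simp: M_def)
qed

text \<open>The machine that maps \<open>p\<close> to the first \<open>n\<close> bits of its oracle, where \<open>n\<close> is the length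
  of \<open>U p\<close>, shows this bound.\<close>

lemma KX_restr_le:
  assumes "universal_machine U"
  shows "\<exists>c. \<forall>X n. KX U X (restr X n) \<le> Kn U n + c"
proof -
  define M :: machine where
    "M X p = map_option (\<lambda>s. restr X (length s)) (U empty_real p)" for X p
  obtain e where e: "\<And>X p q. U X p = Some q \<longleftrightarrow> computes X e [str_code p] (str_code q)"
    using assms unfolding universal_machine_def prefix_free_machine_def computable_machine_def
    by blast
  have "recf 1 (\<lambda>X xs. str_code (restr X (length (str_decode (xs ! 0)))))"
    unfolding str_code_restr by (intro recf_intros recf_length_str_decode) auto
  then obtain d where "\<And>X xs. length xs = 1 \<Longrightarrow>
      computes X d xs (str_code (restr X (length (str_decode (xs ! 0)))))"
    unfolding recf_def by blast
  from this[of "[_]"] have d: "computes X d [y] (str_code (restr X (length (str_decode y))))" for X y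
    by simp
  \<comment> \<open>\<open>no_query e\<close> runs \<open>U\<close> on the empty oracle, whereas
    \<open>d\<close> reads the actual oracle \<open>X\<close>.\<close>
  have "M X p = Some q \<longleftrightarrow> computes X (Comp d [no_query e]) [str_code p] (str_code q)" for X p q
  proof
    assume "M X p = Some q"
    then obtain s where s: "U empty_real p = Some s" "q = restr X (length s)"
      by (auto simp: M_def)
    with d[of X "str_code s"] e show "computes X (Comp d [no_query e]) [str_code p] (str_code q)"
      by (auto intro!: computes.comp[where ys = "[str_code s]"] simp: computes_no_query)
  next
    assume "computes X (Comp d [no_query e]) [str_code p] (str_code q)"
    then obtain ys where "list_all2 (\<lambda>g y. computes X g [str_code p] y) [no_query e] ys"
      and q: "computes X d ys (str_code q)"
      by (cases rule: computes.cases) auto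
    then obtain y where ys: "ys = [y]" and "computes empty_real e [str_code p] y"
      by (auto simp: list_all2_Cons1 computes_no_query)
    then have "U empty_real p = Some (str_decode y)"
      using e[of empty_real p "str_decode y"] by simp
    moreover from q d[of X y] ys have "str_code q = str_code (restr X (length (str_decode y)))"
      by (auto dest: computes_functional)
    ultimately show "M X p = Some q"
      using inj_str_code by (simp add: M_def inj_eq)
  qed
  then have "computable_machine M"
    unfolding computable_machine_def by blast
  \<comment> \<open>Halting depends on \<open>U empty_real\<close> alone, so prefix-freeness is
    inherited for every oracle.\<close>
  moreover have "dom (M X) = dom (U empty_real)" for X
    by (auto simp: M_def)
  ultimately have "prefix_free_machine M"
    using assms unfolding prefix_free_machine_def universal_machine_def by simp
  then obtain r where r: "\<And>X p. U X (r @ p) = M X p"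
    using assms unfolding universal_machine_def by blast
  have "KX U X (restr X n) \<le> Kn U n + length r" for X n
  proof -
    obtain p where p: "U empty_real p = Some (replicate n False)" "length p = Kn U n"
      using universal_machine_onto[OF assms] KX_attained unfolding Kn_def K_def by metis
    then have "U X (r @ p) = Some (restr X n)" by (simp add: r M_def)
    from KX_le[of U, OF this] p(2) show ?thesis by simp
  qed
  then show ?thesis by blast
qed

text \<open>Stage \<open>t\<close> tries the programs with code below \<open>t\<close> under
  \<open>t\<close>-bounded evaluation and keeps the least length that yields the string; a shortest
  program is eventually seen to halt.\<close>

lemma K_approximation:
  assumes "universal_machine U"
  obtains H where "recf 2 (\<lambda>X xs. H (xs ! 0) (xs ! 1))"
    "\<And>s. eventually (\<lambda>t. H t (str_code s) = K U s) at_top"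
proof -
  obtain e where e: "\<And>X p q. U X p = Some q \<longleftrightarrow> computes X e [str_code p] (str_code q)"
    using assms unfolding universal_machine_def prefix_free_machine_def computable_machine_def
    by blast
  define P where "P t n c \<longleftrightarrow>
    (\<exists>x<t. length (str_decode x) = n \<and> eval_upto empty_real t e [x] = Suc c)" for t n c
  \<comment> \<open>The alternative \<open>t \<le> n\<close> makes the search total; it causes an
    underestimate only while \<open>t\<close> is below the true complexity.\<close>
  define H where "H t c = (LEAST n. t \<le> n \<or> P t n c)" for t c
  show thesis
  proof (rule that)
    show "recf 2 (\<lambda>X xs. H (xs ! 0) (xs ! 1))"
      unfolding H_def P_def
      by (intro recf_Least recp_disj recp_le recp_ex_less recp_conj recp_eq recf_Suc
          recf_length_str_decode recf_eval_upto_empty[where k = "Suc 0"] recl_Cons recl_Nil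
          recf_nth recf_drop_nth recf_drop_drop_nth) auto
    fix s
    obtain p where p: "U empty_real p = Some s" "length p = K U s"
      using universal_machine_onto[OF assms] KX_attained unfolding K_def by metis
    \<comment> \<open>By soundness of evaluation every program found is genuine, so none is too
      short.\<close>
    have K_le: "K U s \<le> n" if "P t n (str_code s)" for t n
    proof -
      from that obtain x where x: "length (str_decode x) = n"
        "computes empty_real e [x] (str_code s)"
        unfolding P_def by (auto dest: computes_if_eval_upto)
      then have "U empty_real (str_decode x) = Some s" by (simp add: e)
      from KX_le[of U, OF this] x(1) show ?thesis by (simp add: K_def)
    qed
    have "eventually (\<lambda>t. eval_upto empty_real t e [str_code p] = Suc (str_code s)) at_top"
      using p(1) by (simp add: e computes_iff_eventually_eval_upto)
    with eventually_gt_at_top[of "str_code p"] eventually_gt_at_top[of "K U s"]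
    show "eventually (\<lambda>t. H t (str_code s) = K U s) at_top"
    proof eventually_elim
      case (elim t)
      then have "P t (K U s) (str_code s)"
        unfolding P_def by (intro exI[of _ "str_code p"]) (simp add: p(2))
      with elim show ?case
        unfolding H_def by (intro Least_equality) (auto dest: K_le)
    qed
  qed
qed

section \<open>The order \<open>g\<close>, its lift \<open>f\<close> to strings, and the two
  exclusions\<close>

theorem proposition1p3:
  fixes U :: machine and A :: cantor
  assumes "universal_machine U"
    and "Delta2_real A"
    and "\<not> K_trivial U A"
  shows "A \<notin> KT_Delta2 U \<and> A \<notin> LK_Delta2 U"
proof -
  \<comment> \<open>Truncated subtraction gives 0 where \<open>A\<close> restricted to
    \<open>n\<close> is no more complex than \<open>n\<close>; only large values matter.\<close>
  define h where "h n = K U (restr A n) - Kn U n" for n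
  define g where "g n = runmax h n div 2" for n
  have h_unbounded: "\<exists>n. b < h n" for b
  proof -
    obtain n where "\<not> K U (restr A n) \<le> Kn U n + b"
      using assms(3) unfolding K_trivial_def by blast
    then show ?thesis by (intro exI[of _ n]) (simp add: h_def)
  qed
  have mono_g: "mono g"
    unfolding g_def by (intro monoI div_le_mono monoD[OF mono_runmax])
  have g_unbounded: "\<exists>n. b < g n" for b
  proof -
    \<comment> \<open>Then \<open>h n\<close> is at least 2 * b + 2, whose half exceeds
      \<open>b\<close>.\<close>
    obtain n where "2 * b + 1 < h n" using h_unbounded by blast
    with le_runmax[of n n h] show ?thesis by (intro exI[of _ n]) (simp add: g_def)
  qed
  have not_KT: "A \<notin> KT U g"
  proof
    assume "A \<in> KT U g"
    then obtain c where c: "\<And>n. K U (restr A n) \<le> Kn U n + g n + c"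
      unfolding KT_def by blast
    \<comment> \<open>At a record value r, \<open>h m \<le> g m + c\<close> reads r \<le> r div 2 +
      c, which fails for r > 2 * c + 1.\<close>
    obtain n where n: "2 * c + 1 < h n" using h_unbounded by blast
    obtain m where m: "h m = runmax h n" "runmax h m = runmax h n"
      using runmax_attained by blast
    from c[of m] have "h m \<le> g m + c" by (simp add: h_def)
    with m n le_runmax[of n n h] show False by (simp add: g_def)
  qed

  obtain a where rec_a: "recp 2 (\<lambda>X xs. a (xs ! 0) (xs ! 1))"
    and lim_a: "\<And>n. eventually (\<lambda>t. a t n = A n) at_top"
    using Delta2_real_approximation[OF assms(2)] by blast
  obtain H where rec_H: "recf 2 (\<lambda>X xs. H (xs ! 0) (xs ! 1))"
    and lim_H: "\<And>s. eventually (\<lambda>t. H t (str_code s) = K U s) at_top"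
    using K_approximation[OF assms(1)] by blast
  \<comment> \<open>Writing the zeros as \<open>restr empty_real n\<close> lets
    \<open>str_code_restr\<close> handle both codes.\<close>
  define ht where "ht t n = H t (str_code (restr (a t) n)) - H t (str_code (restr empty_real n))"
    for t n
  have rec_ht: "recf 2 (\<lambda>X xs. ht (xs ! 0) (xs ! 1))"
    unfolding ht_def str_code_restr
    by (intro recf_intros recf_comp2[OF rec_H] recf_comp2[OF rec_a[unfolded recp_def]]) auto
  have rec_g: "recf 2 (\<lambda>X xs. runmax (ht (xs ! 0)) (xs ! 1) div 2)"
    unfolding runmax_def
    by (intro recf_intros recf_div_2 recf_max recf_comp2[OF rec_ht]) auto
  have lim_ht: "eventually (\<lambda>t. ht t n = h n) at_top" for n
  proof -
    \<comment> \<open>\<open>lim_H\<close> concerns one fixed string, so the first \<open>n\<close>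
      bits of the approximation must have settled on those of \<open>A\<close>.\<close>
    have "eventually (\<lambda>t. \<forall>m\<in>{..<n}. a t m = A m) at_top"
      using lim_a by (intro eventually_ball_finite) auto
    with lim_H[of "restr A n"] lim_H[of "restr empty_real n"] show ?thesis
    proof eventually_elim
      case (elim t)
      then have "restr (a t) n = restr A n" by (intro restr_cong) auto
      with elim show ?case
        by (simp add: ht_def h_def Kn_def replicate_False_eq_restr)
    qed
  qed
  have lim_g: "eventually (\<lambda>t. runmax (ht t) n div 2 = g n) at_top" for n
  proof -
    have "eventually (\<lambda>t. \<forall>m\<in>{..n}. ht t m = h m) at_top"
      using lim_ht by (intro eventually_ball_finite) auto
    then show ?thesis
    proof eventually_elim
      case (elim t)
      then have "runmax (ht t) n = runmax h n" by (intro runmax_cong) auto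
      then show ?case by (simp add: g_def)
    qed
  qed
  have "limit_computable g"
    unfolding limit_computable_def using rec_g lim_g
    by (intro exI[of _ "\<lambda>t n. runmax (ht t) n div 2"]) simp
  then have "A \<notin> KT_Delta2 U"
    using not_KT mono_g g_unbounded Delta2_fun_if_limit_computable
    unfolding KT_Delta2_def is_order_def by blast

  define f where "f s = g (length s)" for s :: "bool list"
  have "is_order (f \<circ> str_decode)"
    unfolding is_order_def
  proof (intro conjI allI)
    show "mono (f \<circ> str_decode)"
      using mono_g mono_length_str_decode by (simp add: f_def mono_def)
    fix b
    obtain n where "b < g n" using g_unbounded by blast
    then show "\<exists>n. b < (f \<circ> str_decode) n"
      by (intro exI[of _ "str_code (restr A n)"]) (simp add: f_def)
  qed
  moreover have "Delta2_fun (f \<circ> str_decode)"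
  proof (rule Delta2_fun_if_limit_computable)
    have "recf 2 (\<lambda>X xs. runmax (ht (xs ! 0)) (length (str_decode (xs ! 1))) div 2)"
      by (intro recf_comp2[OF rec_g] recf_length_str_decode recf_nth) auto
    with lim_g show "limit_computable (f \<circ> str_decode)"
      unfolding limit_computable_def f_def comp_def
      by (intro exI[of _ "\<lambda>t n. runmax (ht t) (length (str_decode n)) div 2"]) simp
  qed
  moreover have "A \<notin> LK U f"
  proof
    assume "A \<in> LK U f"
    then obtain c where c: "\<And>s. K U s \<le> KX U A s + f s + c"
      unfolding LK_def by blast
    obtain d where d: "\<And>n. KX U A (restr A n) \<le> Kn U n + d"
      using KX_restr_le[OF assms(1)] by blast
    \<comment> \<open>On initial segments of \<open>A\<close> the two bounds combine to membership
      in \<open>KT U g\<close>, with constant \<open>c + d\<close>.\<close>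
    have "K U (restr A n) \<le> Kn U n + g n + (c + d)" for n
      using c[of "restr A n"] d[of n] by (simp add: f_def)
    with not_KT show False unfolding KT_def by blast
  qed
  ultimately have "A \<notin> LK_Delta2 U"
    unfolding LK_Delta2_def by blast
  with \<open>A \<notin> KT_Delta2 U\<close> show ?thesis by blast
qed

end
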